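(* Let $m<s<M$ be real numbers, let $\kappa=\frac12(s-2m-M)$, let $\phi$ be the cuspon profile with parameters $m,s,M$, and let $u(0,x)=\phi(x)+\kappa$. Let $y_0:\mathbb{R}\to\mathbb{R}$ be the initial characteristic $$y_0(\xi)=\sup\left\{y\ \middle|\ \int_{-\infty}^{y}\phi_x^2(z)\,dz+y<\xi\right\}.$$ Then there is a unique $\bar\xi\in\mathbb{R}$ with $y_0(\bar\xi)=0$, and $$\{\bar\xi\}=\{\xi\in\mathbb{R}\mid y_{0,\xi}(\xi)=0\}.$$
   Context: The cuspon profile with parameters $m<s<M$ is the continuous function $\phi:\mathbb{R}\to\mathbb{R}$, differentiable on $\mathbb{R}\setminus\{0\}$, given implicitly by $$\phi_x^2=\frac{(M-\phi)(\phi-m)^2}{s-\phi}\quad\text{on }\mathbb{R}\setminus\{0\},$$ together with $\phi(-x)=\phi(x)$, $\phi(0)=s$, $\phi_x(x)<0$ for $x>0$, and $\lim_{x\to\infty}\phi(x)=m$. The associated cuspon with exponential decay, $u(t,x)=\phi(x-(s+\kappa)t)+\kappa$, is a travelling wave solution of the Camassa--Holm equation $u_t-u_{txx}+3uu_x-2u_xu_{xx}-uu_{xxx}=0$. Here $y_{0,\xi}$ denotes the pointwise derivative of $y_0$; the set $\{\xi\mid y_{0,\xi}(\xi)=0\}$ is the set of points in Lagrangian coordinates where wave breaking occurs at time $t=0$. *)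

theory Defs
  imports "HOL-Analysis.Analysis"
begin

(* For x \<noteq> 0 the other clauses force \<phi> x < s, so the quotient below never has denominator 0. *)
definition cuspon_profile :: "real \<Rightarrow> real \<Rightarrow> real \<Rightarrow> (real \<Rightarrow> real) \<Rightarrow> bool" where
  "cuspon_profile m s M \<phi> \<longleftrightarrow>
     continuous_on UNIV \<phi> \<and>
     (\<forall>x. x \<noteq> 0 \<longrightarrow> \<phi> differentiable at x) \<and>
     (\<forall>x. x \<noteq> 0 \<longrightarrow> (deriv \<phi> x)\<^sup>2 = (M - \<phi> x) * (\<phi> x - m)\<^sup>2 / (s - \<phi> x)) \<and>
     (\<forall>x. \<phi> (- x) = \<phi> x) \<and>
     \<phi> 0 = s \<and>
     (\<forall>x>0. deriv \<phi> x < 0) \<and>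
     (\<phi> \<longlongrightarrow> m) at_top"

(* The derivative of a cuspon profile does not exist at 0; the (arbitrary) value of
   deriv there is irrelevant, since a single point is a Lebesgue null set. *)
definition initial_characteristic :: "(real \<Rightarrow> real) \<Rightarrow> real \<Rightarrow> real" where
  "initial_characteristic f \<xi> = Sup {y. (LBINT z:{..y}. (deriv f z)\<^sup>2) + y < \<xi>}"

end

theory Submission
  imports Defs
begin

text \<open>
  Let \<open>h y\<close> be the energy \<open>\<integral>\<phi>\<^sub>x\<^sup>2\<close> to the left of \<open>y\<close>, plus \<open>y\<close>. Once \<open>\<phi>\<^sub>x\<^sup>2\<close> is known to be
  integrable, \<open>h\<close> is a continuous, strictly increasing bijection of the line, and the initial
  characteristic is its inverse, so it vanishes exactly at \<open>h 0\<close>. Away from the crest the density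
  \<open>\<phi>\<^sub>x\<^sup>2\<close> is continuous, hence \<open>h\<close> has the finite derivative \<open>1 + \<phi>\<^sub>x\<^sup>2\<close> there, and the derivative
  of an inverse cannot vanish at the image of such a point (\<open>DERIV_left_inverse_nonzero\<close>).
  At the crest the slope of \<open>h\<close> blows up, because the denominator \<open>s - \<phi>\<close> tends to 0 while the
  numerator tends to \<open>(M - s) (s - m)\<^sup>2 > 0\<close>; so the graph of \<open>h\<close> has a vertical tangent and that of
  its inverse a horizontal one (\<open>DERIV_inverse_zero_at_vertical_tangent\<close>).

  The remaining analytic point is that the blow-up is integrable (\<open>energy_density_half_line\<close>).
  On the right half-line \<open>\<phi>\<^sub>x\<^sup>2 = - \<phi>\<^sub>x \<cdot> (\<phi> - m) sqrt ((M - \<phi>) / (s - \<phi>))\<close>, and the second factor is at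
  most \<open>C / sqrt (s - \<phi>)\<close> with a constant \<open>C\<close>. The bound \<open>- C \<phi>\<^sub>x / sqrt (s - \<phi>)\<close> is nonnegative and
  is the derivative of the bounded function \<open>2 C sqrt (s - \<phi>)\<close>. The left half-line follows by
  symmetry.
\<close>

section \<open>The Lagrangian label of an integrable density\<close>

definition label_map :: "(real \<Rightarrow> real) \<Rightarrow> real \<Rightarrow> real" where
  "label_map f y = (LBINT z:{..y}. f z) + y"

text \<open>
  Rewriting increments as gauge integrals over compact intervals makes the fundamental theorem of
  calculus available for the Lebesgue integral over a half-line.
\<close>

lemma label_map_split:
  assumes "integrable lborel f" and "a \<le> b"
  shows "f integrable_on {a..b}"
    and "label_map f b = label_map f a + integral {a..b} f + (b - a)"
proof -
  have si: "set_integrable lborel S f" if "S \<in> sets borel" for S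
    unfolding set_integrable_def
    by (rule integrable_mult_indicator[OF _ assms(1)]) (simp add: that)
  show int: "f integrable_on {a..b}"
    by (rule set_borel_integral_eq_integral(1)[OF si]) simp
  have intl: "f integrable_on {..y}" for y
    by (rule set_borel_integral_eq_integral(1)[OF si]) simp
  have eq: "label_map f y = integral {..y} f + y" for y
    unfolding label_map_def by (subst set_borel_integral_eq_integral(2)[OF si]) auto
  have "{..a} \<union> {a..b} = {..b}" "{..a} \<inter> {a..b} = {a}"
    using assms(2) by auto
  then have "integral {..b} f = integral {..a} f + integral {a..b} f"
    using integral_Un[OF intl[of a] int] by simp
  then show "label_map f b = label_map f a + integral {a..b} f + (b - a)"
    by (simp add: eq)
qed

text \<open>
  This one estimate is the source of strict monotonicity, of surjectivity, and of the Lipschitz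
  continuity of the inverse.
\<close>

lemma label_map_expanding:
  assumes "integrable lborel f" and "\<And>x. 0 \<le> f x" and "a \<le> b"
  shows "b - a \<le> label_map f b - label_map f a"
proof -
  have "0 \<le> integral {a..b} f"
    by (rule integral_nonneg[OF label_map_split(1)[OF assms(1,3)]]) (simp add: assms(2))
  then show ?thesis
    using label_map_split(2)[OF assms(1,3)] by simp
qed

lemma strict_mono_label_map:
  assumes "integrable lborel f" and "\<And>x. 0 \<le> f x"
  shows "strict_mono (label_map f)"
proof (rule strict_monoI)
  fix a b :: real
  assume "a < b"
  then show "label_map f a < label_map f b"
    using label_map_expanding[OF assms, of a b] by simp
qed

lemma continuous_on_label_map:
  assumes "integrable lborel f"
  shows "continuous_on {a..b} (label_map f)"
proof -
  have "continuous_on {a..b} (\<lambda>y. label_map f a + integral {a..y} f + (y - a))"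
  proof (cases "a \<le> b")
    case True
    show ?thesis
      by (intro continuous_intros indefinite_integral_continuous_1
            label_map_split(1)[OF assms True])
  qed simp
  then show ?thesis
    by (rule continuous_on_eq) (use label_map_split(2)[OF assms] in auto)
qed

lemma surj_label_map:
  assumes "integrable lborel f" and "\<And>x. 0 \<le> f x"
  shows "surj (label_map f)"
proof -
  have "\<exists>y. label_map f y = \<xi>" for \<xi>
  proof -
    define r where "r = \<bar>\<xi> - label_map f 0\<bar>"
    have "label_map f (- r) \<le> \<xi>" "\<xi> \<le> label_map f r"
      using label_map_expanding[OF assms, of "- r" 0] label_map_expanding[OF assms, of 0 r]
      by (auto simp: r_def)
    then show ?thesis
      using IVT'[of "label_map f" "- r" \<xi> r] continuous_on_label_map[OF assms(1)]
      by (auto simp: r_def)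
  qed
  then show ?thesis by (metis surjI surj_def)
qed

lemma DERIV_label_map:
  assumes "integrable lborel f" and "isCont f y"
  shows "(label_map f has_real_derivative 1 + f y) (at y)"
proof -
  let ?I = "{y - 1..y + 1}"
  have "((\<lambda>u. integral {y - 1..u} f) has_vector_derivative f y) (at y within ?I - {})"
    by (rule integral_has_vector_derivative_continuous_at)
      (use assms label_map_split(1)[OF assms(1)] in
        \<open>auto intro: continuous_at_imp_continuous_at_within\<close>)
  then have "((\<lambda>u. integral {y - 1..u} f) has_real_derivative f y) (at y)"
    by (simp add: at_within_Icc_at has_real_derivative_iff_has_vector_derivative)
  then have "((\<lambda>u. label_map f (y - 1) + integral {y - 1..u} f + (u - (y - 1)))
      has_real_derivative 1 + f y) (at y)"
    by (auto intro!: derivative_eq_intros)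
  then show ?thesis
  proof (rule has_field_derivative_transform_within[where d = 1])
    fix x :: real
    assume "dist x y < 1"
    then have "y - 1 \<le> x" by (simp add: dist_real_def)
    then show "label_map f (y - 1) + integral {y - 1..x} f + (x - (y - 1)) = label_map f x"
      by (rule label_map_split(2)[OF assms(1), symmetric])
  qed simp_all
qed

text \<open>
  By monotonicity the sublevel set is an open half-line; this is why the supremum that defines the
  initial characteristic inverts the label map.
\<close>

lemma Sup_label_map_sublevel:
  assumes "integrable lborel f" and "\<And>x. 0 \<le> f x"
  shows "Sup {y. label_map f y < label_map f a} = a"
proof -
  have "{y. label_map f y < label_map f a} = {..<a}"
    using strict_mono_less[OF strict_mono_label_map[OF assms]] by auto
  then show ?thesis by simp
qed

section \<open>Critical points of an inverse function\<close>

text \<open>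
  The chain rule for \<open>g \<circ> h\<close> gives \<open>c * d = 1\<close>.
\<close>

lemma DERIV_left_inverse_nonzero:
  fixes g h :: "real \<Rightarrow> real"
  assumes "(h has_real_derivative d) (at y)" and "(g has_real_derivative c) (at (h y))"
    and "\<And>x. g (h x) = x"
  shows "c \<noteq> 0"
proof
  assume "c = 0"
  have "((\<lambda>x. g (h x)) has_real_derivative c * d) (at y)"
    by (rule DERIV_chain2[OF assms(2,1)])
  then have "((\<lambda>x. x) has_real_derivative 0) (at y)"
    by (simp add: assms(3) \<open>c = 0\<close>)
  then show False
    using DERIV_unique[OF _ DERIV_ident] by fastforce
qed

text \<open>
  The difference quotient of the inverse \<open>g\<close> at \<open>h p\<close> is the reciprocal of one of \<open>h\<close> at \<open>p\<close>, which
  by the mean value theorem is a slope \<open>d z\<close> with \<open>z\<close> between \<open>p\<close> and \<open>g \<xi>\<close>. Continuity of \<open>g\<close> forces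
  \<open>z\<close> to \<open>p\<close>, where the slopes tend to infinity.
\<close>

lemma DERIV_inverse_zero_at_vertical_tangent:
  fixes g h :: "real \<Rightarrow> real"
  assumes cont: "\<And>a b. continuous_on {a..b} h"
    and deriv: "\<And>y. y \<noteq> p \<Longrightarrow> (h has_real_derivative d y) (at y)"
    and blowup: "filterlim d at_top (at p)"
    and inv: "\<And>\<xi>. h (g \<xi>) = \<xi>" and p: "g (h p) = p"
    and contg: "isCont g (h p)"
  shows "(g has_real_derivative 0) (at (h p))"
proof -
  have diff: "h differentiable (at y)" if "y \<noteq> p" for y
    using deriv[OF that] real_differentiable_def by blast
  \<comment> \<open>Difference quotients of h at p equal slopes at intermediate points, on either side of p.\<close>
  have mvt: "\<exists>z. z \<noteq> p \<and> \<bar>z - p\<bar> < \<bar>y - p\<bar> \<and> h y - h p = (y - p) * d z" if "y \<noteq> p" for y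
  proof (cases "p < y")
    case True
    obtain l z where z: "p < z" "z < y" "(h has_real_derivative l) (at z)"
      "h y - h p = (y - p) * l"
      using MVT[OF True cont] diff by (metis less_irrefl)
    moreover have "l = d z" using DERIV_unique[OF z(3) deriv] z(1) by simp
    ultimately show ?thesis by (intro exI[of _ z]) auto
  next
    case False
    with that have "y < p" by simp
    then obtain l z where z: "y < z" "z < p" "(h has_real_derivative l) (at z)"
      "h p - h y = (p - y) * l"
      using MVT[OF \<open>y < p\<close> cont] diff by (metis less_irrefl)
    moreover have "l = d z" using DERIV_unique[OF z(3) deriv] z(2) by simp
    ultimately show ?thesis by (intro exI[of _ z]) (auto simp: algebra_simps)
  qed
  have "((\<lambda>\<xi>. (g \<xi> - g (h p)) / (\<xi> - h p)) \<longlongrightarrow> 0) (at (h p))"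
  proof (rule tendstoI)
    fix e :: real
    assume "0 < e"
    have "eventually (\<lambda>z. inverse e < d z) (at p)"
      using blowup by (simp add: filterlim_at_top_dense)
    then obtain r where r: "0 < r" "\<And>z. z \<noteq> p \<Longrightarrow> \<bar>z - p\<bar> < r \<Longrightarrow> inverse e < d z"
      unfolding eventually_at by (auto simp: dist_real_def)
    have "eventually (\<lambda>\<xi>. dist (g \<xi>) (g (h p)) < r) (at (h p))"
      using contg r(1) unfolding isCont_def by (rule tendstoD)
    moreover have "eventually (\<lambda>\<xi>. \<xi> \<noteq> h p) (at (h p))"
      by (simp add: eventually_at_filter)
    ultimately show "eventually (\<lambda>\<xi>. dist ((g \<xi> - g (h p)) / (\<xi> - h p)) 0 < e) (at (h p))"
    proof eventually_elim
      case (elim \<xi>)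
      have ne: "g \<xi> \<noteq> p"
        using elim(2) inv by metis
      obtain z where z: "z \<noteq> p" "\<bar>z - p\<bar> < \<bar>g \<xi> - p\<bar>" "\<xi> - h p = (g \<xi> - p) * d z"
        using mvt[OF ne] inv by metis
      have big: "inverse e < d z"
        using r(2)[OF z(1)] z(2) elim(1) p by (simp add: dist_real_def)
      have "0 < d z"
        using big \<open>0 < e\<close> by (meson inverse_positive_iff_positive less_trans)
      moreover from this have "inverse (d z) < e"
        using big \<open>0 < e\<close> by (metis inverse_inverse_eq inverse_less_iff_less
            inverse_positive_iff_positive)
      moreover have "(g \<xi> - g (h p)) / (\<xi> - h p) = inverse (d z)"
        using ne by (simp add: z(3) p inverse_eq_divide)
      ultimately show ?case by simp
    qed
  qed
  then show ?thesis by (simp add: has_field_derivative_iff)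
qed

section \<open>The energy density of the cuspon\<close>

lemma cuspon_profile_less_crest:
  assumes "cuspon_profile m s M \<phi>" and "x \<noteq> 0"
  shows "\<phi> x < s"
proof -
  have pos: "\<phi> x < s" if "0 < x" for x
  proof -
    have "\<phi> 0 > \<phi> x"
    proof (rule DERIV_neg_imp_decreasing_open[OF that])
      show "\<exists>d. (\<phi> has_real_derivative d) (at t) \<and> d < 0" if "0 < t" "t < x" for t
        using assms(1) that
        by (metis cuspon_profile_def DERIV_deriv_iff_real_differentiable less_irrefl)
      show "continuous_on {0..x} \<phi>"
        using assms(1) by (auto simp: cuspon_profile_def intro: continuous_on_subset)
    qed
    then show ?thesis using assms(1) by (simp add: cuspon_profile_def)
  qed
  show ?thesis
    using pos[of x] pos[of "- x"] assms by (cases "0 < x") (auto simp: cuspon_profile_def)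
qed

text \<open>
  On the right half-line the profile decreases to its limit \<open>m\<close>; evenness carries the bound to the
  left, and the crest lies above all other values.
\<close>

lemma cuspon_profile_ge_trough:
  assumes "cuspon_profile m s M \<phi>"
  shows "m \<le> \<phi> x"
proof -
  have anti: "\<phi> b \<le> \<phi> a" if "0 < a" "a \<le> b" for a b
  proof (rule DERIV_nonpos_imp_nonincreasing[OF that(2)])
    show "\<exists>d. (\<phi> has_real_derivative d) (at t) \<and> d \<le> 0" if "a \<le> t" "t \<le> b" for t
      using assms that \<open>0 < a\<close>
      by (metis cuspon_profile_def DERIV_deriv_iff_real_differentiable less_irrefl
          less_le_trans less_imp_le)
  qed
  have lim: "(\<phi> \<longlongrightarrow> m) at_top" and "\<phi> 0 = s" and even: "\<And>x. \<phi> (- x) = \<phi> x"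
    using assms by (auto simp: cuspon_profile_def)
  have pos: "m \<le> \<phi> x" if "0 < x" for x
    by (rule tendsto_upperbound[OF lim])
      (use anti[OF that] in \<open>auto simp: eventually_at_top_linorder\<close>)
  have "\<phi> 1 < s"
    using cuspon_profile_less_crest[OF assms] by simp
  with pos[of 1] \<open>\<phi> 0 = s\<close> have "m \<le> \<phi> 0" by simp
  with pos[of x] pos[of "- x"] even show ?thesis
    by (cases x "0 :: real" rule: linorder_cases) auto
qed

text \<open>
  The right-hand side of the profile equation. It is used in place of the squared derivative,
  with which it agrees off the crest, because its continuity and symmetry are evident.
\<close>

definition energy_density :: "real \<Rightarrow> real \<Rightarrow> real \<Rightarrow> (real \<Rightarrow> real) \<Rightarrow> real \<Rightarrow> real" where
  "energy_density m s M \<phi> x = (M - \<phi> x) * (\<phi> x - m)\<^sup>2 / (s - \<phi> x)"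

lemma isCont_energy_density:
  assumes "cuspon_profile m s M \<phi>" and "x \<noteq> 0"
  shows "isCont (energy_density m s M \<phi>) x"
proof -
  have "isCont \<phi> x"
    using assms(1) by (simp add: cuspon_profile_def continuous_on_eq_continuous_at)
  then show ?thesis
    unfolding energy_density_def
    using cuspon_profile_less_crest[OF assms] by (intro continuous_intros) auto
qed

lemma energy_density_at_top:
  assumes "m < s" and "s < M" and "cuspon_profile m s M \<phi>"
  shows "filterlim (energy_density m s M \<phi>) at_top (at 0)"
proof -
  have lim: "\<phi> \<midarrow>0\<rightarrow> s"
    using assms(3) by (metis UNIV_I cuspon_profile_def continuous_on_eq_continuous_at
        isCont_def open_UNIV)
  have "eventually (\<lambda>x. 0 < s - \<phi> x) (at 0)"
    using cuspon_profile_less_crest[OF assms(3)] by (auto simp: eventually_at_filter)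
  moreover have "((\<lambda>x. (M - \<phi> x) * (\<phi> x - m)\<^sup>2) \<longlongrightarrow> (M - s) * (s - m)\<^sup>2) (at 0)"
    by (intro tendsto_intros lim)
  moreover have "((\<lambda>x. s - \<phi> x) \<longlongrightarrow> s - s) (at 0)"
    by (intro tendsto_intros lim)
  ultimately show ?thesis
    unfolding energy_density_def using assms by (intro LIM_at_top_divide) auto
qed

text \<open>
  The profile equation only determines the derivative up to sign; monotonicity selects the
  negative root.
\<close>

lemma DERIV_cuspon_profile:
  assumes "cuspon_profile m s M \<phi>" and "0 < x"
  shows "(\<phi> has_real_derivative - sqrt (energy_density m s M \<phi> x)) (at x)"
proof -
  have "(\<phi> has_real_derivative deriv \<phi> x) (at x)"
    using assms by (simp add: cuspon_profile_def DERIV_deriv_iff_real_differentiable)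
  moreover have "energy_density m s M \<phi> x = (- deriv \<phi> x)\<^sup>2" and "deriv \<phi> x < 0"
    using assms by (simp_all add: cuspon_profile_def energy_density_def)
  ultimately show ?thesis by (simp add: real_sqrt_abs)
qed

lemma energy_density_nonneg:
  assumes "cuspon_profile m s M \<phi>"
  shows "0 \<le> energy_density m s M \<phi> x"
proof (cases "x = 0")
  case True
  then show ?thesis using assms by (simp add: energy_density_def cuspon_profile_def)
next
  case False
  then show ?thesis
    using assms unfolding cuspon_profile_def energy_density_def by (metis zero_le_power2)
qed

text \<open>
  The square-root singularity at the crest and the infinite length of the half-line are handled
  at once: the density is dominated by the derivative of \<open>2 C sqrt (s - \<phi>)\<close>, which increases from
  0 at the crest to the finite value \<open>2 C sqrt (s - m)\<close> at infinity.
\<close>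

lemma energy_density_half_line:
  assumes "m < s" and "s < M" and cusp: "cuspon_profile m s M \<phi>"
  shows "set_integrable lborel {0<..} (energy_density m s M \<phi>)"
proof -
  let ?e = "energy_density m s M \<phi>"
  define C where "C = (s - m) * sqrt (M - m)"
  define G where "G = (\<lambda>x. 2 * C * sqrt (s - \<phi> x))"
  define G' where "G' = (\<lambda>x. C * sqrt (?e x) / sqrt (s - \<phi> x))"
  have "0 \<le> C" using assms by (simp add: C_def)
  have less: "\<phi> x < s" if "0 < x" for x
    using cuspon_profile_less_crest[OF cusp] that by simp
  have cont: "isCont \<phi> x" for x
    using cusp by (simp add: cuspon_profile_def continuous_on_eq_continuous_at)
  have "\<phi> 0 = s" and lim: "(\<phi> \<longlongrightarrow> m) at_top"
    using cusp by (auto simp: cuspon_profile_def)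
  have dom: "?e x \<le> G' x" if "0 < x" for x
  proof -
    have "\<phi> x - m \<le> s - m" "0 \<le> \<phi> x - m" "M - \<phi> x \<le> M - m"
      using less[OF that] cuspon_profile_ge_trough[OF cusp, of x] by auto
    then have "(\<phi> x - m) * sqrt (M - \<phi> x) \<le> C"
      unfolding C_def using less[OF that] assms by (intro mult_mono) auto
    moreover have "sqrt (?e x) = (\<phi> x - m) * sqrt (M - \<phi> x) / sqrt (s - \<phi> x)"
      using \<open>0 \<le> \<phi> x - m\<close>
      by (simp add: energy_density_def real_sqrt_divide real_sqrt_mult)
    ultimately have "sqrt (?e x) \<le> C / sqrt (s - \<phi> x)"
      using less[OF that] by (simp add: divide_right_mono)
    then have "sqrt (?e x) * sqrt (?e x) \<le> sqrt (?e x) * (C / sqrt (s - \<phi> x))"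
      using energy_density_nonneg[OF cusp] by (intro mult_left_mono) auto
    then show ?thesis
      using energy_density_nonneg[OF cusp] by (simp add: G'_def mult.commute)
  qed
  have "set_integrable lborel (einterval 0 \<infinity>) G'"
  proof (rule interval_integral_FTC_nonneg(1)[where F = G and A = 0
        and B = "2 * C * sqrt (s - m)"])
    fix x :: real
    assume "0 < ereal x"
    then have "0 < x" by simp
    show "(G has_real_derivative G' x) (at x)"
      unfolding G_def G'_def using less[OF \<open>0 < x\<close>]
      by (auto intro!: derivative_eq_intros DERIV_cuspon_profile[OF cusp \<open>0 < x\<close>]
          simp: field_simps)
    show "isCont G' x"
      unfolding G'_def using less[OF \<open>0 < x\<close>] \<open>0 < x\<close>
      by (intro continuous_intros cont isCont_energy_density[OF cusp]) auto
  next
    show "AE x in lborel. 0 < ereal x \<longrightarrow> ereal x < \<infinity> \<longrightarrow> 0 \<le> G' x"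
    proof (rule AE_I2, intro impI)
      fix x :: real assume "0 < ereal x"
      then show "0 \<le> G' x"
        using dom[of x] energy_density_nonneg[OF cusp, of x] by simp
    qed
  next
    have "isCont G 0"
      unfolding G_def by (intro continuous_intros cont)
    then have "(G \<longlongrightarrow> G 0) (at_right 0)"
      unfolding isCont_def by (rule filterlim_mono) (auto intro: at_le)
    then show "((G \<circ> real_of_ereal) \<longlongrightarrow> 0) (at_right 0)"
      using \<open>\<phi> 0 = s\<close> by (simp add: G_def zero_ereal_def ereal_tendsto_simps)
    show "((G \<circ> real_of_ereal) \<longlongrightarrow> 2 * C * sqrt (s - m)) (at_left \<infinity>)"
      unfolding ereal_tendsto_simps G_def by (intro tendsto_intros lim)
  qed simp
  moreover have "einterval 0 \<infinity> = {0<..}" by (auto simp: einterval_def)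
  ultimately have "set_integrable lborel {0<..} G'" by simp
  then show ?thesis
  proof (rule set_integrable_bound)
    have "continuous_on {0<..} ?e"
      using isCont_energy_density[OF cusp] by (auto intro: continuous_at_imp_continuous_on)
    then show "set_borel_measurable lborel {0<..} ?e"
      unfolding set_borel_measurable_def
      using borel_measurable_continuous_on_indicator[of "{0<..}" ?e] by simp
    show "AE x in lborel. x \<in> {0<..} \<longrightarrow> norm (?e x) \<le> norm (G' x)"
      using dom energy_density_nonneg[OF cusp] by (auto intro!: AE_I2)
        (meson abs_ge_self order_trans)
  qed
qed

lemma integrable_deriv_square:
  assumes "m < s" and "s < M" and cusp: "cuspon_profile m s M \<phi>"
  shows "integrable lborel (\<lambda>x. (deriv \<phi> x)\<^sup>2)"
proof -
  let ?e = "energy_density m s M \<phi>"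
  have right: "integrable lborel (\<lambda>x. indicator {0<..} x * ?e x)"
    using energy_density_half_line[OF assms] by (simp add: set_integrable_def)
  have "integrable lborel (\<lambda>x. indicator {0<..} (0 + - 1 * x) * ?e (0 + - 1 * x))"
    by (rule lborel_integrable_real_affine[OF right]) simp
  moreover have "?e (- x) = ?e x" for x
    using cusp by (simp add: energy_density_def cuspon_profile_def)
  ultimately have left: "integrable lborel (\<lambda>x. indicator {0<..} (- x) * ?e x)"
    by simp
  \<comment> \<open>At the crest, deriv has an unspecified value, which needs a correction on a null set.\<close>
  have "integrable lborel (\<lambda>x. indicator {0 :: real} x * (deriv \<phi> 0)\<^sup>2)"
    by (rule integrable_mult_left) simp
  then have "integrable lborel (\<lambda>x. indicator {0<..} x * ?e x + indicator {0<..} (- x) * ?e x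
      + indicator {0 :: real} x * (deriv \<phi> 0)\<^sup>2)"
    by (intro Bochner_Integration.integrable_add left right)
  moreover have "(\<lambda>x. indicator {0<..} x * ?e x + indicator {0<..} (- x) * ?e x
      + indicator {0 :: real} x * (deriv \<phi> 0)\<^sup>2) = (\<lambda>x. (deriv \<phi> x)\<^sup>2)"
    using cusp
    by (intro ext) (auto simp: indicator_def cuspon_profile_def energy_density_def)
  ultimately show ?thesis by simp
qed

section \<open>Wave breaking for the cuspon\<close>

theorem mainTheorem2:
  fixes m s M \<kappa> :: real
    and \<phi> :: "real \<Rightarrow> real"
    and u :: "real \<Rightarrow> real \<Rightarrow> real"
    and y0 :: "real \<Rightarrow> real"
  assumes "m < s" and "s < M"
    and "\<kappa> = 1 / 2 * (s - 2 * m - M)"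
    and "cuspon_profile m s M \<phi>"
    and "\<And>x. u 0 x = \<phi> x + \<kappa>"
    and "y0 = initial_characteristic \<phi>"
  shows "(\<exists>!\<xi>b. y0 \<xi>b = 0) \<and>
         (\<forall>\<xi>b. y0 \<xi>b = 0 \<longrightarrow> {\<xi>b} = {\<xi>. (y0 has_real_derivative 0) (at \<xi>)})"
proof -
  let ?e = "energy_density m s M \<phi>"
  define f where "f = (\<lambda>x. (deriv \<phi> x)\<^sup>2)"
  define h where "h = label_map f"
  note cusp = assms(4)
  have int: "integrable lborel f" and nonneg: "\<And>x. 0 \<le> f x"
    unfolding f_def using integrable_deriv_square[OF assms(1,2) cusp] by auto
  have f_eq: "f x = ?e x" if "x \<noteq> 0" for x
    using cusp that by (simp add: f_def cuspon_profile_def energy_density_def)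
  have y0h: "y0 (h y) = y" for y
    using Sup_label_map_sublevel[OF int nonneg, of y]
    by (simp add: assms(6) initial_characteristic_def h_def label_map_def f_def)
  have hy0: "h (y0 \<xi>) = \<xi>" for \<xi>
    using surj_label_map[OF int nonneg] y0h unfolding h_def by (metis surjD)
  have deriv: "(h has_real_derivative 1 + f y) (at y)" if "y \<noteq> 0" for y
  proof -
    have "eventually (\<lambda>x. x \<noteq> 0) (nhds y)"
      using that by (rule t1_space_nhds)
    then have "eventually (\<lambda>x. f x = ?e x) (nhds y)"
      by eventually_elim (rule f_eq)
    then have "isCont f y"
      using isCont_energy_density[OF cusp that] by (simp cong: isCont_cong)
    then show ?thesis
      unfolding h_def by (rule DERIV_label_map[OF int])
  qed
  have "filterlim f at_top (at 0)"
    using energy_density_at_top[OF assms(1,2) cusp]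
    by (rule filterlim_mono_eventually) (auto simp: eventually_at_filter f_eq)
  then have blowup: "filterlim (\<lambda>y. 1 + f y) at_top (at 0)"
    by (rule filterlim_tendsto_add_at_top[OF tendsto_const])
  \<comment> \<open>Since h expands distances, its inverse is 1-Lipschitz.\<close>
  have lip: "dist (y0 a) (y0 b) \<le> dist a b" for a b
    using label_map_expanding[OF int nonneg, of "y0 a" "y0 b"]
      label_map_expanding[OF int nonneg, of "y0 b" "y0 a"] hy0[unfolded h_def]
    by (cases "y0 a \<le> y0 b") (auto simp: dist_real_def)
  have "isCont y0 (h 0)"
    unfolding continuous_at_eps_delta using lip le_less_trans by blast
  then have zero: "(y0 has_real_derivative 0) (at (h 0))"
    using DERIV_inverse_zero_at_vertical_tangent[OF _ deriv blowup hy0 y0h]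
      continuous_on_label_map[OF int] unfolding h_def by blast
  have only: "\<xi> = h 0" if "(y0 has_real_derivative 0) (at \<xi>)" for \<xi>
  proof (rule ccontr)
    assume "\<xi> \<noteq> h 0"
    then have "y0 \<xi> \<noteq> 0" using hy0 by metis
    from DERIV_left_inverse_nonzero[OF deriv[OF this], of y0 0] show False
      using that y0h by (simp add: hy0)
  qed
  have root: "y0 \<xi> = 0 \<longleftrightarrow> \<xi> = h 0" for \<xi>
    using hy0 y0h by metis
  have "{\<xi>. (y0 has_real_derivative 0) (at \<xi>)} = {h 0}"
    using zero only by blast
  then show ?thesis by (simp add: root)
qed

end
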